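(* Let $I\subseteq\mathbb{R}$ be an interval containing $0$, let $a,b,c,d,g,h:I\to\mathbb{R}$ be continuous, and let $g_0,h_0$ be nonzero real constants. Suppose $\alpha,\beta,\gamma:I\to\mathbb{R}$ are differentiable functions satisfying on $I$ $$\dot\alpha+b+2c\alpha+4a\alpha^2=0,\qquad \dot\beta+(c+4a\alpha)\beta=0,\qquad \dot\gamma+a\beta^2=0,$$ and suppose that on $I$ $$d=-2a\alpha,\qquad g=g_0\,a\beta^2,\qquad h=h_0\,a\beta^2 .$$ Put $\theta(x,t)=\alpha(t)x^2+\beta(t)x+\gamma(t)$ and $\xi(x,t)=\beta(t)x+2\gamma(t)$. Let $\xi_0\in\mathbb{R}$ and $\sigma\in\{1,-1\}$ be arbitrary. Then, with $G$ any of the functions listed below, the pair $$\psi(x,t)=e^{i\theta(x,t)}\,G(\xi(x,t)),\qquad \varphi(x,t)=e^{-i\theta(x,t)}\,G(\xi(x,t))$$ is a solution, for $x\in\mathbb{R}$, $t\in I$, of the coupled system $$i\psi_t=-a(t)\psi_{xx}+b(t)x^2\psi-ic(t)x\psi_x-id(t)\psi+g(t)\psi+h(t)(|\psi|^2+|\varphi|^2)\psi,$$ $$i\varphi_t=a(t)\varphi_{xx}-b(t)x^2\varphi-ic(t)x\varphi_x-id(t)\varphi-g(t)\varphi-h(t)(|\psi|^2+|\varphi|^2)\varphi.$$ Case 1: $h_0<0$ and $g_0>0$. For a real constant $H_0$ set (when the right-hand sides are nonnegative, and taking nonnegative square roots) $$G_1^2=\frac{g_0-\sqrt{g_0^2-8h_0H_0}}{-2h_0},\quad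 G_2^2=\frac{g_0+\sqrt{g_0^2-8h_0H_0}}{-2h_0},\quad G_3^2=\frac{-g_0+\sqrt{g_0^2-8h_0H_0}}{-2h_0}.$$ (a) If $H_0\in\left(\frac{g_0^2}{8h_0},0\right)$: $\;G(\xi)=\sigma\,G_2\,\mathrm{dn}\!\left(G_2\sqrt{-h_0}\,(\xi-\xi_0);\ \frac{\sqrt{G_2^2-G_1^2}}{G_2}\right)$. (b) (corresponding to $H_0=0$): $\;G(\xi)=\sigma\sqrt{-g_0/h_0}\ \mathrm{sech}\!\left(\sqrt{g_0}\,(\xi-\xi_0)\right)$. (c) (corresponding to $H_0=\frac{g_0^2}{8h_0}$): $\;G(\xi)=\sigma\sqrt{-g_0/(2h_0)}$ (constant). (d) If $H_0>0$: $\;G(\xi)=\sigma\,G_2\,\mathrm{cn}\!\left(\sqrt{-h_0}\sqrt{G_2^2+G_3^2}\,(\xi-\xi_0);\ \frac{G_2}{\sqrt{G_2^2+G_3^2}}\right)$. Case 2: $h_0>0$ and $g_0<0$. For a real constant $H_0$ set $$G_1^2=\frac{-g_0-\sqrt{g_0^2-8h_0H_0}}{2h_0},\qquad G_2^2=\frac{-g_0+\sqrt{g_0^2-8h_0H_0}}{2h_0},$$ with $G_1,G_2\ge 0$. (a) If $H_0\in\left(0,\frac{g_0^2}{8h_0}\right)$: $\;G(\xi)=\sigma\,G_1\,\mathrm{sn}\!\left(\sqrt{h_0}\,G_2\,(\xi-\xi_0);\ \frac{G_1}{G_2}\right)$. (b) (corresponding to $H_0=\frac{g_0^2}{8h_0}$):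 $\;G(\xi)=\sigma\sqrt{-g_0/(2h_0)}\ \tanh\!\left(\sqrt{-g_0/2}\,(\xi-\xi_0)\right)$.
   Context: A dot denotes $d/dt$; subscripts $x,t$ denote partial derivatives; $\psi,\varphi$ are complex-valued functions of real $x,t$. $\mathrm{sn}(u;l)$, $\mathrm{cn}(u;l)$, $\mathrm{dn}(u;l)$ are the Jacobi elliptic functions with modulus $l\in(0,1)$ (not parameter $m=l^2$): $\mathrm{sn}(\cdot;l)$ is the solution of $y'^2=(1-y^2)(1-l^2y^2)$ with $y(0)=0$, $y'(0)=1$ extended smoothly to $\mathbb{R}$ (equivalently $y''=-(1+l^2)y+2l^2y^3$), $\mathrm{cn}(\cdot;l)$ is the smooth function with $\mathrm{cn}(0;l)=1$ and $\mathrm{cn}^2=1-\mathrm{sn}^2$, $\mathrm{cn}'=-\mathrm{sn}\,\mathrm{dn}$, and $\mathrm{dn}=\sqrt{1-l^2\,\mathrm{sn}^2}>0$. The constant $H_0$ is the value of the Hamiltonian $H(G,P)=\frac12P^2-\frac{g_0}{2}G^2-\frac{h_0}{2}G^4$, $P=G'$. *)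

theory Defs
  imports "HOL-Analysis.Analysis"
begin

text \<open>
  Jacobi elliptic functions of a real argument. The first argument \<open>l\<close> is the modulus,
  not the parameter \<open>l\<^sup>2\<close>.

  The initial value problem \<open>y'\<^sup>2 = (1 - y\<^sup>2)(1 - l\<^sup>2y\<^sup>2)\<close>, \<open>y(0) = 0\<close>, \<open>y'(0) = 1\<close> alone does not
  determine \<open>y\<close> beyond the first point where \<open>y = 1\<close> (one may continue by a constant). The
  smooth continuation is the one that also satisfies the differentiated equation
  \<open>y'' = -(1 + l\<^sup>2)y + 2l\<^sup>2y\<^sup>3\<close>.
\<close>

definition is_jacobi_sn :: "real \<Rightarrow> (real \<Rightarrow> real) \<Rightarrow> bool" where
  "is_jacobi_sn l y \<longleftrightarrow>
     y 0 = 0 \<and>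
     (\<exists>y'. y' 0 = 1 \<and>
       (\<forall>u. (y has_real_derivative y' u) (at u)) \<and>
       (\<forall>u. (y' u)\<^sup>2 = (1 - (y u)\<^sup>2) * (1 - l\<^sup>2 * (y u)\<^sup>2)) \<and>
       (\<forall>u. (y' has_real_derivative - (1 + l\<^sup>2) * y u + 2 * l\<^sup>2 * (y u) ^ 3) (at u)))"

definition jacobi_sn :: "real \<Rightarrow> real \<Rightarrow> real" where
  "jacobi_sn l = (THE y. is_jacobi_sn l y)"

definition jacobi_dn :: "real \<Rightarrow> real \<Rightarrow> real" where
  "jacobi_dn l u = sqrt (1 - l\<^sup>2 * (jacobi_sn l u)\<^sup>2)"

definition is_jacobi_cn :: "real \<Rightarrow> (real \<Rightarrow> real) \<Rightarrow> bool" where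
  "is_jacobi_cn l y \<longleftrightarrow>
     y 0 = 1 \<and>
     (\<forall>u. (y u)\<^sup>2 = 1 - (jacobi_sn l u)\<^sup>2) \<and>
     (\<forall>u. (y has_real_derivative - jacobi_sn l u * jacobi_dn l u) (at u))"

definition jacobi_cn :: "real \<Rightarrow> real \<Rightarrow> real" where
  "jacobi_cn l = (THE y. is_jacobi_cn l y)"

definition sech :: "real \<Rightarrow> real" where
  "sech u = 1 / cosh u"

text \<open>
  Amplitudes of the profiles: suffix \<open>foc\<close> for the regime \<open>h0 < 0 < g0\<close>, suffix \<open>defoc\<close> for
  \<open>g0 < 0 < h0\<close>. The squares are the zeros, up to sign, of
  \<open>X \<mapsto> h0 X\<^sup>2 + g0 X + 2 H0\<close>. They are meaningful only when the radicand of the outer root is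
  nonnegative, because \<open>sqrt\<close> is odd on the reals.
\<close>

definition G1_foc :: "real \<Rightarrow> real \<Rightarrow> real \<Rightarrow> real" where
  "G1_foc g0 h0 H0 = sqrt ((g0 - sqrt (g0\<^sup>2 - 8 * h0 * H0)) / (- 2 * h0))"

definition G2_foc :: "real \<Rightarrow> real \<Rightarrow> real \<Rightarrow> real" where
  "G2_foc g0 h0 H0 = sqrt ((g0 + sqrt (g0\<^sup>2 - 8 * h0 * H0)) / (- 2 * h0))"

definition G3_foc :: "real \<Rightarrow> real \<Rightarrow> real \<Rightarrow> real" where
  "G3_foc g0 h0 H0 = sqrt ((- g0 + sqrt (g0\<^sup>2 - 8 * h0 * H0)) / (- 2 * h0))"

definition G1_defoc :: "real \<Rightarrow> real \<Rightarrow> real \<Rightarrow> real" where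
  "G1_defoc g0 h0 H0 = sqrt ((- g0 - sqrt (g0\<^sup>2 - 8 * h0 * H0)) / (2 * h0))"

definition G2_defoc :: "real \<Rightarrow> real \<Rightarrow> real \<Rightarrow> real" where
  "G2_defoc g0 h0 H0 = sqrt ((- g0 + sqrt (g0\<^sup>2 - 8 * h0 * H0)) / (2 * h0))"

text \<open>
  Classical solutions on \<open>\<real> \<times> I\<close>. Time derivatives are taken within \<open>I\<close>, so they are one-sided at
  end points belonging to \<open>I\<close>. The fields are written \<open>\<psi> x t\<close>, \<open>\<phi> x t\<close>.
\<close>

definition solves_coupled_nls ::
  "real set \<Rightarrow> (real \<Rightarrow> real) \<Rightarrow> (real \<Rightarrow> real) \<Rightarrow> (real \<Rightarrow> real) \<Rightarrow> (real \<Rightarrow> real) \<Rightarrow>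
   (real \<Rightarrow> real) \<Rightarrow> (real \<Rightarrow> real) \<Rightarrow>
   (real \<Rightarrow> real \<Rightarrow> complex) \<Rightarrow> (real \<Rightarrow> real \<Rightarrow> complex) \<Rightarrow> bool" where
  "solves_coupled_nls I a b c d g h \<psi> \<phi> \<longleftrightarrow>
     (\<exists>\<psi>t \<psi>x \<psi>xx \<phi>t \<phi>x \<phi>xx.
       \<forall>x. \<forall>t\<in>I.
         ((\<lambda>s. \<psi> x s) has_vector_derivative \<psi>t x t) (at t within I) \<and>
         ((\<lambda>y. \<psi> y t) has_vector_derivative \<psi>x x t) (at x) \<and>
         ((\<lambda>y. \<psi>x y t) has_vector_derivative \<psi>xx x t) (at x) \<and>
         ((\<lambda>s. \<phi> x s) has_vector_derivative \<phi>t x t) (at t within I) \<and>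
         ((\<lambda>y. \<phi> y t) has_vector_derivative \<phi>x x t) (at x) \<and>
         ((\<lambda>y. \<phi>x y t) has_vector_derivative \<phi>xx x t) (at x) \<and>
         \<i> * \<psi>t x t =
           - of_real (a t) * \<psi>xx x t + of_real (b t) * of_real (x\<^sup>2) * \<psi> x t
           - \<i> * of_real (c t) * of_real x * \<psi>x x t - \<i> * of_real (d t) * \<psi> x t
           + of_real (g t) * \<psi> x t
           + of_real (h t) * of_real ((cmod (\<psi> x t))\<^sup>2 + (cmod (\<phi> x t))\<^sup>2) * \<psi> x t \<and>
         \<i> * \<phi>t x t =
           of_real (a t) * \<phi>xx x t - of_real (b t) * of_real (x\<^sup>2) * \<phi> x t
           - \<i> * of_real (c t) * of_real x * \<phi>x x t - \<i> * of_real (d t) * \<phi> x t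
           - of_real (g t) * \<phi> x t
           - of_real (h t) * of_real ((cmod (\<psi> x t))\<^sup>2 + (cmod (\<phi> x t))\<^sup>2) * \<phi> x t)"

end

theory Submission imports Defs begin

text \<open>
  Inserting the ansatz into the system, the imaginary part cancels by the equations for \<open>\<beta>\<close>, \<open>\<gamma>\<close>
  and the choice of \<open>d\<close>, and the real part reduces to \<open>a \<beta>\<^sup>2\<close> times the Duffing equation
  \<open>G'' = g0 G + 2 h0 G\<^sup>3\<close>; the second field is the complex conjugate of the first. Each profile is a
  rescaling of a Duffing solution. The Jacobi functions are obtained globally from the amplitude
  \<open>am\<close>, the inverse of \<open>\<phi> \<mapsto> \<integral>\<^sub>0\<^sup>\<phi> (1 - l\<^sup>2 sin\<^sup>2 x)\<^sup>-\<^sup>1\<^sup>/\<^sup>2 dx\<close>, as \<open>sn = sin \<circ> am\<close> and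
  \<open>cn = cos \<circ> am\<close>; uniqueness, needed since they are definite descriptions, is a Gronwall argument.
\<close>

section \<open>The Duffing equation and its scaling\<close>

definition solves_duffing :: "real \<Rightarrow> real \<Rightarrow> (real \<Rightarrow> real) \<Rightarrow> bool" where
  "solves_duffing p q y \<longleftrightarrow>
     (\<exists>y'. (\<forall>u. (y has_real_derivative y' u) (at u)) \<and>
           (\<forall>u. (y' has_real_derivative p * y u + q * (y u) ^ 3) (at u)))"

text \<open>Two differentiations bring out the factor \<open>k^2\<close>, and moving the amplitude
  inside the cube costs \<open>A^2\<close>. The relation for \<open>Q\<close> is kept as a product,
  which avoids dividing by \<open>A^2\<close>.\<close>

lemma solves_duffing_rescale:
  assumes "solves_duffing p q y" and "P = k\<^sup>2 * p" and "Q * A\<^sup>2 = k\<^sup>2 * q"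
  shows "solves_duffing P Q (\<lambda>z. A * y (k * (z - z0)))"
proof -
  obtain y' where y: "\<And>u. (y has_real_derivative y' u) (at u)"
    and y': "\<And>u. (y' has_real_derivative p * y u + q * (y u) ^ 3) (at u)"
    using assms(1) unfolding solves_duffing_def by blast
  have "((\<lambda>z. A * y (k * (z - z0))) has_real_derivative A * k * y' (k * (u - z0))) (at u)" for u
    by (rule derivative_eq_intros DERIV_chain2[OF y] refl | simp)+
  moreover have "((\<lambda>z. A * k * y' (k * (z - z0))) has_real_derivative
      P * (A * y (k * (u - z0))) + Q * (A * y (k * (u - z0))) ^ 3) (at u)" for u
  proof -
    let ?v = "y (k * (u - z0))"
    have "Q * (A * ?v) ^ 3 = (Q * A\<^sup>2) * A * ?v ^ 3"
      by algebra
    then have "P * (A * ?v) + Q * (A * ?v) ^ 3 = A * k * ((p * ?v + q * ?v ^ 3) * k)"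
      unfolding assms(2) assms(3) by algebra
    then show ?thesis
      by (auto intro!: derivative_eq_intros DERIV_chain2[OF y'])
  qed
  ultimately show ?thesis
    unfolding solves_duffing_def
    by (intro exI[of _ "\<lambda>z. A * k * y' (k * (z - z0))"]) blast
qed

section \<open>Uniqueness for second-order equations\<close>

lemma gronwall_zero:
  fixes E E' :: "real \<Rightarrow> real"
  assumes deriv: "\<And>t. 0 \<le> t \<Longrightarrow> t \<le> T \<Longrightarrow> (E has_real_derivative E' t) (at t)"
    and bound: "\<And>t. 0 \<le> t \<Longrightarrow> t \<le> T \<Longrightarrow> E' t \<le> K * E t"
    and "E 0 \<le> 0" and "0 \<le> T"
  shows "E T \<le> 0"
proof -
  \<comment> \<open>With the integrating factor \<open>exp (- K * t)\<close>, the bound on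
    \<open>E'\<close> says that a product is nonincreasing.\<close>
  have "exp (- K * T) * E T \<le> exp (- K * 0) * E 0"
  proof (rule DERIV_nonpos_imp_nonincreasing[OF \<open>0 \<le> T\<close>])
    fix t assume t: "0 \<le> t" "t \<le> T"
    have "((\<lambda>t. exp (- K * t) * E t) has_real_derivative exp (- K * t) * (E' t - K * E t)) (at t)"
      by (auto intro!: derivative_eq_intros deriv[OF t] simp: algebra_simps)
    moreover have "exp (- K * t) * (E' t - K * E t) \<le> 0"
      using bound[OF t] by (simp add: mult_le_0_iff)
    ultimately show "\<exists>D. ((\<lambda>t. exp (- K * t) * E t) has_real_derivative D) (at t) \<and> D \<le> 0"
      by blast
  qed
  also have "\<dots> \<le> 0"
    using \<open>E 0 \<le> 0\<close> by simp
  finally show ?thesis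
    by (simp add: mult_le_0_iff)
qed

text \<open>Gronwall is applied to the energy \<open>w^2 + w'^2\<close>: its derivative is
  \<open>(1 + q) * (2 * w * w')\<close>, and \<open>2 * w * w'\<close> is bounded in modulus by the
  energy itself.\<close>

lemma linear_second_order_zero_forward:
  fixes w w' q :: "real \<Rightarrow> real"
  assumes w: "\<And>t. (w has_real_derivative w' t) (at t)"
    and w': "\<And>t. (w' has_real_derivative q t * w t) (at t)"
    and q: "continuous_on UNIV q"
    and "w 0 = 0" and "w' 0 = 0" and "0 \<le> T"
  shows "w T = 0"
proof -
  \<comment> \<open>Continuity bounds \<open>q\<close> only on compact sets, so the Gronwall
    constant depends on the end point \<open>T\<close>.\<close>
  have "bounded (q ` {0..T})"
    by (intro compact_imp_bounded compact_continuous_image continuous_on_subset[OF q]) auto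
  then obtain M where M: "\<And>t. t \<in> {0..T} \<Longrightarrow> \<bar>q t\<bar> \<le> M"
    by (fastforce simp: bounded_iff)
  define E where "E t = (w t)\<^sup>2 + (w' t)\<^sup>2" for t
  have "E T \<le> 0"
  proof (rule gronwall_zero[where E = E and T = T and K = "1 + M"])
    fix t assume t: "0 \<le> t" "t \<le> T"
    show "(E has_real_derivative (1 + q t) * (2 * w t * w' t)) (at t)"
      unfolding E_def
      by (auto intro!: derivative_eq_intros w w' simp: algebra_simps)
    have "(1 + q t) * (2 * w t * w' t) \<le> \<bar>1 + q t\<bar> * \<bar>2 * w t * w' t\<bar>"
      by (metis abs_ge_self abs_mult)
    also have "\<dots> \<le> (1 + M) * E t"
    proof (rule mult_mono)
      show "\<bar>1 + q t\<bar> \<le> 1 + M" "0 \<le> 1 + M"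
        using M[of t] t by auto
      show "\<bar>2 * w t * w' t\<bar> \<le> E t"
        unfolding E_def
        using sum_squares_bound[of "\<bar>w t\<bar>" "\<bar>w' t\<bar>"] by (simp add: abs_mult)
    qed simp
    finally show "(1 + q t) * (2 * w t * w' t) \<le> (1 + M) * E t" .
  qed (use assms in \<open>auto simp: E_def\<close>)
  then have "(w T)\<^sup>2 \<le> 0"
    unfolding E_def using zero_le_power2[of "w' T"] by linarith
  then show ?thesis
    by simp
qed

lemma linear_second_order_zero:
  fixes w w' q :: "real \<Rightarrow> real"
  assumes w: "\<And>t. (w has_real_derivative w' t) (at t)"
    and w': "\<And>t. (w' has_real_derivative q t * w t) (at t)"
    and q: "continuous_on UNIV q"
    and "w 0 = 0" and "w' 0 = 0"
  shows "w t = 0"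
proof (cases "0 \<le> t")
  case True
  then show ?thesis
    using linear_second_order_zero_forward[OF assms] by blast
next
  case False
  \<comment> \<open>Time reversal: \<open>w (- s)\<close> solves an equation of the same kind with
    coefficient \<open>q (- s)\<close>, and \<open>- t\<close> lies on the forward
    half-line.\<close>
  have "w (- (- t)) = 0"
  proof (rule linear_second_order_zero_forward[where w = "\<lambda>s. w (- s)"])
    show "((\<lambda>s. w (- s)) has_real_derivative - w' (- s)) (at s)" for s
      using w DERIV_mirror by blast
    show "((\<lambda>s. - w' (- s)) has_real_derivative q (- s) * w (- s)) (at s)" for s
      using DERIV_minus[OF w'[of "- s", unfolded DERIV_mirror]] by simp
    show "continuous_on UNIV (\<lambda>s. q (- s))"
      by (intro continuous_on_compose2[OF q] continuous_intros) auto
  qed (use assms False in auto)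
  then show ?thesis
    by simp
qed

text \<open>Since \<open>y^3 - z^3 = (y^2 + y * z + z^2) * (y - z)\<close>, the difference of two
  solutions solves a linear equation with a continuous coefficient and zero initial data.\<close>

lemma duffing_unique:
  assumes y: "\<And>u. (y has_real_derivative y' u) (at u)"
      "\<And>u. (y' has_real_derivative p * y u + q * (y u) ^ 3) (at u)"
    and z: "\<And>u. (z has_real_derivative z' u) (at u)"
      "\<And>u. (z' has_real_derivative p * z u + q * (z u) ^ 3) (at u)"
    and init: "y 0 = z 0" "y' 0 = z' 0"
  shows "y = z"
proof
  fix u
  have "y u - z u = 0"
  proof (rule linear_second_order_zero[where w = "\<lambda>u. y u - z u"])
    show "((\<lambda>u. y u - z u) has_real_derivative y' u - z' u) (at u)" for u
      by (intro derivative_intros y z)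
    show "((\<lambda>u. y' u - z' u) has_real_derivative
        (p + q * ((y u)\<^sup>2 + y u * z u + (z u)\<^sup>2)) * (y u - z u)) (at u)" for u
      by (auto intro!: derivative_eq_intros y z simp: algebra_simps power2_eq_square power3_eq_cube)
    have "continuous_on UNIV y" "continuous_on UNIV z"
      using y(1) z(1) by (auto intro!: DERIV_continuous_on)
    then show "continuous_on UNIV (\<lambda>u. p + q * ((y u)\<^sup>2 + y u * z u + (z u)\<^sup>2))"
      by (intro continuous_intros)
  qed (use init in auto)
  then show "y u = z u"
    by simp
qed

section \<open>Global solutions of scalar autonomous equations\<close>

text \<open>Separation of variables: the solution is the inverse of the primitive \<open>F\<close>
  of \<open>1 / f\<close> with \<open>F 0 = 0\<close>. The upper bound \<open>M\<close> keeps the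
  slope of \<open>F\<close> at least \<open>1 / M\<close>, so \<open>F\<close> is onto and the
  solution exists for all times.\<close>

lemma autonomous_ode_exists:
  fixes f :: "real \<Rightarrow> real"
  assumes cont: "continuous_on UNIV f" and pos: "\<And>x. 0 < f x" and le: "\<And>x. f x \<le> M"
  obtains y where "y 0 = 0" and "\<And>u. (y has_real_derivative f (y u)) (at u)"
proof -
  have "isCont (\<lambda>x. 1 / f x) x" for x
    using cont pos[of x] by (intro continuous_intros) (auto simp: continuous_on_eq_continuous_at)
  then obtain F0 where F0: "\<And>x. (F0 has_real_derivative 1 / f x) (at x)"
    using einterval_antiderivative[of "- \<infinity>" "\<infinity>" "\<lambda>x. 1 / f x"]
    by (auto simp: has_real_derivative_iff_has_vector_derivative)
  define F where "F x = F0 x - F0 0" for x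
  have F: "(F has_real_derivative 1 / f x) (at x)" for x
    unfolding F_def by (auto intro!: derivative_eq_intros F0)
  have contF: "isCont F x" for x
    using F DERIV_isCont by blast
  have "strict_mono F"
  proof (rule strict_monoI, rule DERIV_pos_imp_increasing[where f = F])
    show "\<exists>D. (F has_real_derivative D) (at x) \<and> 0 < D" for x
      using F[of x] pos[of x] by (intro exI[of _ "1 / f x"]) simp
  qed
  have M: "0 < M"
    using pos[of 0] le[of 0] by linarith
  have grow: "(v - u) / M \<le> F v - F u" if "u \<le> v" for u v
  proof -
    have "F u - u / M \<le> F v - v / M"
    proof (rule DERIV_nonneg_imp_nondecreasing[OF that])
      fix x
      have "((\<lambda>x. F x - x / M) has_real_derivative 1 / f x - 1 / M) (at x)"
        using M by (auto intro!: derivative_eq_intros F)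
      moreover have "0 \<le> 1 / f x - 1 / M"
        using pos le M by (simp add: frac_le)
      ultimately show "\<exists>D. ((\<lambda>x. F x - x / M) has_real_derivative D) (at x) \<and> 0 \<le> D"
        by blast
    qed
    then show ?thesis
      by (simp add: diff_divide_distrib)
  qed
  have "\<exists>x. v = F x" for v
  proof -
    have "F 0 = 0"
      by (simp add: F_def)
    \<comment> \<open>As \<open>F\<close> grows at least like \<open>x / M\<close>, it has reached
      height \<open>\<bar>v\<bar>\<close> at \<open>M * \<bar>v\<bar>\<close>, and symmetrically on
      the left.\<close>
    then have "F (- (M * \<bar>v\<bar>)) \<le> v" "v \<le> F (M * \<bar>v\<bar>)"
      using grow[of 0 "M * \<bar>v\<bar>"] grow[of "- (M * \<bar>v\<bar>)" 0] M by auto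
    then show ?thesis
      using IVT[of F "- (M * \<bar>v\<bar>)" v "M * \<bar>v\<bar>"] contF M by auto
  qed
  then have "surj F"
    by (simp add: surj_def)
  define y where "y = inv F"
  have Fy: "F (y u) = u" for u
    unfolding y_def using \<open>surj F\<close> by (simp add: surj_f_inv_f)
  have yF: "y (F x) = x" for x
    unfolding y_def using \<open>strict_mono F\<close> by (simp add: strict_mono_eq inv_f_f inj_def)
  show thesis
  proof
    show "y 0 = 0"
      using yF[of 0] by (simp add: F_def)
    fix u
    \<comment> \<open>The derivative rule for inverses asks for continuity of the inverse
      beforehand. The radius 1, here and in the interval around \<open>u\<close> below, is arbitrary
      because \<open>F\<close> is invertible on the whole line.\<close>
    have "isCont y (F (y u))"
      by (rule isCont_inverse_function[where d = 1]) (auto simp: yF contF)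
    then have "(y has_real_derivative inverse (1 / f (y u))) (at u)"
      using pos[of "y u"]
      by (intro DERIV_inverse_function[where f = F and a = "u - 1" and b = "u + 1"])
        (auto simp: F Fy)
    then show "(y has_real_derivative f (y u)) (at u)"
      by simp
  qed
qed

section \<open>Jacobi functions: well-definedness and the amplitude\<close>

text \<open>The differentiated equation is a Duffing equation, which admits only one solution with
  given value and slope at 0.\<close>

lemma is_jacobi_sn_unique:
  assumes "is_jacobi_sn l y" and "is_jacobi_sn l z"
  shows "y = z"
proof -
  obtain y' where y: "y 0 = 0" "y' 0 = 1" "\<And>u. (y has_real_derivative y' u) (at u)"
    "\<And>u. (y' has_real_derivative - (1 + l\<^sup>2) * y u + 2 * l\<^sup>2 * (y u) ^ 3) (at u)"
    using assms(1) unfolding is_jacobi_sn_def by blast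
  obtain z' where z: "z 0 = 0" "z' 0 = 1" "\<And>u. (z has_real_derivative z' u) (at u)"
    "\<And>u. (z' has_real_derivative - (1 + l\<^sup>2) * z u + 2 * l\<^sup>2 * (z u) ^ 3) (at u)"
    using assms(2) unfolding is_jacobi_sn_def by blast
  show ?thesis
    by (rule duffing_unique[OF y(3,4) z(3,4)]) (simp_all add: y z)
qed

text \<open>The derivative is prescribed through \<open>jacobi_sn\<close> and
  \<open>jacobi_dn\<close>, so two candidates differ by a constant, fixed by the value at 0.\<close>

lemma is_jacobi_cn_unique:
  assumes "is_jacobi_cn l y" and "is_jacobi_cn l z"
  shows "y = z"
proof
  fix u
  have "((\<lambda>u. y u - z u) has_real_derivative 0) (at v)" for v
    using assms unfolding is_jacobi_cn_def by (auto intro!: derivative_eq_intros)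
  then have "y u - z u = y 0 - z 0"
    using DERIV_isconst_all[of "\<lambda>u. y u - z u" u 0] by blast
  then show "y u = z u"
    using assms unfolding is_jacobi_cn_def by simp
qed

context
  fixes l :: real
  assumes l: "0 < l" "l < 1"
begin

lemma jacobi_radicand_pos:
  assumes "s\<^sup>2 \<le> 1"
  shows "0 < 1 - l\<^sup>2 * s\<^sup>2"
proof -
  have "l\<^sup>2 * s\<^sup>2 \<le> l\<^sup>2 * 1"
    using assms by (intro mult_left_mono) auto
  also have "\<dots> < 1"
    using l by (simp add: power_less_one_iff)
  finally show ?thesis
    by simp
qed

text \<open>The amplitude solves an autonomous equation whose right-hand side is positive and at
  most 1; positivity is where \<open>l < 1\<close> enters.\<close>

lemma jacobi_amplitude_exists:
  obtains am where "am 0 = 0"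
    and "\<And>u. (am has_real_derivative sqrt (1 - l\<^sup>2 * (sin (am u))\<^sup>2)) (at u)"
proof -
  have "continuous_on UNIV (\<lambda>x. sqrt (1 - l\<^sup>2 * (sin x)\<^sup>2))"
    by (intro continuous_intros)
  moreover have "0 < sqrt (1 - l\<^sup>2 * (sin x)\<^sup>2)" for x
    using jacobi_radicand_pos[of "sin x"] by (simp add: sin_squared_eq)
  moreover have "sqrt (1 - l\<^sup>2 * (sin x)\<^sup>2) \<le> 1" for x
    by simp
  ultimately show thesis
    using that by (rule autonomous_ode_exists)
qed

text \<open>The compositions of \<open>sin\<close> and \<open>cos\<close> with the amplitude satisfy
  the defining conditions, hence by uniqueness they are the definite descriptions. Later facts about
  the Jacobi functions reduce to trigonometry through this.\<close>

lemma jacobi_functions_amplitude: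
  obtains am where "\<And>u. (am has_real_derivative jacobi_dn l u) (at u)"
    and "\<And>u. jacobi_sn l u = sin (am u)" and "\<And>u. jacobi_cn l u = cos (am u)"
proof -
  obtain am where am0: "am 0 = 0"
    and am: "\<And>u. (am has_real_derivative sqrt (1 - l\<^sup>2 * (sin (am u))\<^sup>2)) (at u)"
    by (rule jacobi_amplitude_exists) blast
  \<comment> \<open>\<open>D\<close> plays the part of \<open>jacobi_dn l\<close> until
    \<open>jacobi_sn l\<close> has been identified.\<close>
  define D where "D u = sqrt (1 - l\<^sup>2 * (sin (am u))\<^sup>2)" for u
  have am_deriv: "(am has_real_derivative D u) (at u)" for u
    unfolding D_def by (rule am)
  have pos: "0 < 1 - l\<^sup>2 * (sin (am u))\<^sup>2" for u
    using jacobi_radicand_pos[of "sin (am u)"] by (simp add: sin_squared_eq)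
  then have D: "0 < D u" "(D u)\<^sup>2 = 1 - l\<^sup>2 * (sin (am u))\<^sup>2" for u
    by (simp_all add: D_def less_imp_le)
  have D_deriv: "(D has_real_derivative - l\<^sup>2 * sin (am u) * cos (am u)) (at u)" for u
  proof -
    have "((\<lambda>u. sqrt (1 - l\<^sup>2 * (sin (am u))\<^sup>2)) has_real_derivative
        (- (l\<^sup>2 * (2 * sin (am u) * (cos (am u) * D u)))) / (2 * D u)) (at u)"
      using pos[of u] unfolding D_def
      by (auto intro!: derivative_eq_intros am simp: field_simps)
    moreover have "(- (l\<^sup>2 * (2 * sin (am u) * (cos (am u) * D u)))) / (2 * D u)
        = - l\<^sup>2 * sin (am u) * cos (am u)"
      using D(1)[of u] by (simp add: field_simps)
    ultimately show ?thesis
      unfolding D_def by simp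
  qed
  have "is_jacobi_sn l (\<lambda>u. sin (am u))"
    unfolding is_jacobi_sn_def
  proof (intro conjI exI[of _ "\<lambda>u. cos (am u) * D u"] allI)
    fix u
    show "((\<lambda>u. sin (am u)) has_real_derivative cos (am u) * D u) (at u)"
      by (auto intro!: derivative_eq_intros am_deriv)
    show "(cos (am u) * D u)\<^sup>2 = (1 - (sin (am u))\<^sup>2) * (1 - l\<^sup>2 * (sin (am u))\<^sup>2)"
      by (simp add: power_mult_distrib D(2) cos_squared_eq)
    have "- sin (am u) * D u * D u + cos (am u) * (- l\<^sup>2 * sin (am u) * cos (am u))
        = - sin (am u) * (D u)\<^sup>2 - l\<^sup>2 * sin (am u) * (cos (am u))\<^sup>2"
      by algebra
    also have "\<dots> = - (1 + l\<^sup>2) * sin (am u) + 2 * l\<^sup>2 * (sin (am u)) ^ 3"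
      unfolding D(2) cos_squared_eq by algebra
    finally show "((\<lambda>u. cos (am u) * D u) has_real_derivative
        - (1 + l\<^sup>2) * sin (am u) + 2 * l\<^sup>2 * (sin (am u)) ^ 3) (at u)"
      by (auto intro!: derivative_eq_intros am_deriv D_deriv simp: mult_ac)
  qed (auto simp: am0 D_def)
  then have sn: "jacobi_sn l = (\<lambda>u. sin (am u))"
    unfolding jacobi_sn_def using is_jacobi_sn_unique by blast
  then have dn: "jacobi_dn l u = D u" for u
    by (simp add: jacobi_dn_def D_def)
  \<comment> \<open>The conditions on \<open>cn\<close> refer to \<open>jacobi_sn\<close> and
    \<open>jacobi_dn\<close>, which is why those two are identified first.\<close>
  have "is_jacobi_cn l (\<lambda>u. cos (am u))"
    unfolding is_jacobi_cn_def sn dn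
    by (auto intro!: derivative_eq_intros am_deriv simp: am0 cos_squared_eq)
  then have cn: "jacobi_cn l = (\<lambda>u. cos (am u))"
    unfolding jacobi_cn_def using is_jacobi_cn_unique by blast
  show thesis
    using that[of am] am_deriv by (simp add: sn cn dn)
qed

text \<open>With these relations the second derivatives below become polynomial identities that
  \<open>algebra\<close> can decide.\<close>

lemma jacobi_squares:
  "(jacobi_cn l u)\<^sup>2 = 1 - (jacobi_sn l u)\<^sup>2"
  "0 < jacobi_dn l u"
  "(jacobi_dn l u)\<^sup>2 = 1 - l\<^sup>2 * (jacobi_sn l u)\<^sup>2"
proof -
  obtain am where am: "\<And>u. jacobi_sn l u = sin (am u)" "\<And>u. jacobi_cn l u = cos (am u)"
    by (rule jacobi_functions_amplitude) blast
  show "(jacobi_cn l u)\<^sup>2 = 1 - (jacobi_sn l u)\<^sup>2"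
    by (simp add: am cos_squared_eq)
  have "0 < 1 - l\<^sup>2 * (jacobi_sn l u)\<^sup>2"
    using jacobi_radicand_pos[of "jacobi_sn l u"] by (simp add: am sin_squared_eq)
  then show "0 < jacobi_dn l u" "(jacobi_dn l u)\<^sup>2 = 1 - l\<^sup>2 * (jacobi_sn l u)\<^sup>2"
    by (simp_all add: jacobi_dn_def)
qed

section \<open>Derivatives and Duffing equations of the Jacobi functions\<close>

lemma jacobi_sn_deriv:
  "(jacobi_sn l has_real_derivative jacobi_cn l u * jacobi_dn l u) (at u)"
proof -
  obtain am where am: "\<And>u. (am has_real_derivative jacobi_dn l u) (at u)"
    "\<And>u. jacobi_sn l u = sin (am u)" "\<And>u. jacobi_cn l u = cos (am u)"
    by (rule jacobi_functions_amplitude) blast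
  then have "jacobi_sn l = (\<lambda>u. sin (am u))"
    by blast
  then show ?thesis
    by (auto intro!: derivative_eq_intros am(1) simp: am(3))
qed

lemma jacobi_cn_deriv:
  "(jacobi_cn l has_real_derivative - jacobi_sn l u * jacobi_dn l u) (at u)"
proof -
  obtain am where am: "\<And>u. (am has_real_derivative jacobi_dn l u) (at u)"
    "\<And>u. jacobi_sn l u = sin (am u)" "\<And>u. jacobi_cn l u = cos (am u)"
    by (rule jacobi_functions_amplitude) blast
  then have "jacobi_cn l = (\<lambda>u. cos (am u))"
    by blast
  then show ?thesis
    by (auto intro!: derivative_eq_intros am(1) simp: am(2))
qed

text \<open>The chain rule for the root leaves \<open>jacobi_dn\<close> in the denominator, where it
  cancels against the factor coming from the derivative of \<open>jacobi_sn\<close>.\<close>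

lemma jacobi_dn_deriv:
  "(jacobi_dn l has_real_derivative - l\<^sup>2 * jacobi_sn l u * jacobi_cn l u) (at u)"
proof -
  have rad: "0 < 1 - l\<^sup>2 * (jacobi_sn l u)\<^sup>2"
    using jacobi_squares(2,3)[of u] by (metis zero_less_power)
  have "((\<lambda>u. 1 - l\<^sup>2 * (jacobi_sn l u)\<^sup>2) has_real_derivative
      - (l\<^sup>2 * (2 * jacobi_sn l u * (jacobi_cn l u * jacobi_dn l u)))) (at u)"
    by (auto intro!: derivative_eq_intros jacobi_sn_deriv)
  from DERIV_chain2[OF DERIV_real_sqrt[OF rad] this]
  have "(jacobi_dn l has_real_derivative inverse (jacobi_dn l u) / 2 *
      - (l\<^sup>2 * (2 * jacobi_sn l u * (jacobi_cn l u * jacobi_dn l u)))) (at u)"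
    unfolding jacobi_dn_def[abs_def] .
  moreover have "inverse (jacobi_dn l u) / 2 *
      - (l\<^sup>2 * (2 * jacobi_sn l u * (jacobi_cn l u * jacobi_dn l u)))
      = - l\<^sup>2 * jacobi_sn l u * jacobi_cn l u"
    using jacobi_squares(2)[of u] by (simp add: field_simps)
  ultimately show ?thesis
    by metis
qed

lemma solves_duffing_jacobi_sn: "solves_duffing (- (1 + l\<^sup>2)) (2 * l\<^sup>2) (jacobi_sn l)"
  unfolding solves_duffing_def
proof (intro exI[of _ "\<lambda>u. jacobi_cn l u * jacobi_dn l u"] conjI allI)
  fix u
  let ?s = "jacobi_sn l u" and ?c = "jacobi_cn l u" and ?d = "jacobi_dn l u"
  have "- ?s * ?d * ?d + ?c * (- l\<^sup>2 * ?s * ?c) = - (1 + l\<^sup>2) * ?s + 2 * l\<^sup>2 * ?s ^ 3"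
    using jacobi_squares(1,3)[of u] by algebra
  then show "((\<lambda>u. jacobi_cn l u * jacobi_dn l u) has_real_derivative
      - (1 + l\<^sup>2) * ?s + 2 * l\<^sup>2 * ?s ^ 3) (at u)"
    by (auto intro!: derivative_eq_intros jacobi_cn_deriv jacobi_dn_deriv simp: mult_ac)
qed (rule jacobi_sn_deriv)

lemma solves_duffing_jacobi_cn: "solves_duffing (2 * l\<^sup>2 - 1) (- 2 * l\<^sup>2) (jacobi_cn l)"
  unfolding solves_duffing_def
proof (intro exI[of _ "\<lambda>u. - jacobi_sn l u * jacobi_dn l u"] conjI allI)
  fix u
  let ?s = "jacobi_sn l u" and ?c = "jacobi_cn l u" and ?d = "jacobi_dn l u"
  have "- (?c * ?d) * ?d - ?s * (- l\<^sup>2 * ?s * ?c) = (2 * l\<^sup>2 - 1) * ?c + (- 2 * l\<^sup>2) * ?c ^ 3"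
    using jacobi_squares(1,3)[of u] by algebra
  then show "((\<lambda>u. - jacobi_sn l u * jacobi_dn l u) has_real_derivative
      (2 * l\<^sup>2 - 1) * ?c + (- 2 * l\<^sup>2) * ?c ^ 3) (at u)"
    by (auto intro!: derivative_eq_intros jacobi_sn_deriv jacobi_dn_deriv simp: mult_ac)
qed (rule jacobi_cn_deriv)

lemma solves_duffing_jacobi_dn: "solves_duffing (2 - l\<^sup>2) (- 2) (jacobi_dn l)"
  unfolding solves_duffing_def
proof (intro exI[of _ "\<lambda>u. - l\<^sup>2 * jacobi_sn l u * jacobi_cn l u"] conjI allI)
  fix u
  let ?s = "jacobi_sn l u" and ?c = "jacobi_cn l u" and ?d = "jacobi_dn l u"
  have "- l\<^sup>2 * (?c * ?d) * ?c - l\<^sup>2 * ?s * (- ?s * ?d) = (2 - l\<^sup>2) * ?d + (- 2) * ?d ^ 3"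
    using jacobi_squares(1,3)[of u] by algebra
  then show "((\<lambda>u. - l\<^sup>2 * jacobi_sn l u * jacobi_cn l u) has_real_derivative
      (2 - l\<^sup>2) * ?d + (- 2) * ?d ^ 3) (at u)"
    by (auto intro!: derivative_eq_intros jacobi_sn_deriv jacobi_cn_deriv simp: mult_ac)
qed (rule jacobi_dn_deriv)

end

section \<open>Hyperbolic limits\<close>

text \<open>The coefficients are those of both \<open>cn\<close> and \<open>dn\<close> at
  \<open>l = 1\<close>, a modulus outside the range of the Jacobi lemmas.\<close>

lemma solves_duffing_sech: "solves_duffing 1 (- 2) sech"
  unfolding solves_duffing_def
proof (intro exI[of _ "\<lambda>u. - sech u * tanh u"] conjI allI)
  have nz: "cosh u \<noteq> 0" for u :: real
    using cosh_real_pos[of u] by simp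
  show sech_deriv: "(sech has_real_derivative - sech u * tanh u) (at u)" for u
    unfolding sech_def[abs_def] tanh_def
    by (auto intro!: derivative_eq_intros simp: nz power2_eq_square)
  fix u :: real
  have "(tanh u)\<^sup>2 = 1 - (sech u)\<^sup>2"
    using nz[of u] by (simp add: tanh_def sech_def sinh_square_eq field_simps)
  then have "- (- sech u * tanh u) * tanh u - sech u * (1 - (tanh u)\<^sup>2)
      = 1 * sech u + (- 2) * sech u ^ 3"
    by algebra
  then show "((\<lambda>u. - sech u * tanh u) has_real_derivative
      1 * sech u + (- 2) * sech u ^ 3) (at u)"
    by (auto intro!: derivative_eq_intros sech_deriv simp: nz mult_ac)
qed

text \<open>The coefficients are those of \<open>sn\<close> at \<open>l = 1\<close>.\<close>

lemma solves_duffing_tanh: "solves_duffing (- 2) 2 (tanh :: real \<Rightarrow> real)"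
  unfolding solves_duffing_def
proof (intro exI[of _ "\<lambda>u. 1 - (tanh u)\<^sup>2"] conjI allI)
  fix u :: real
  have nz: "cosh u \<noteq> 0"
    using cosh_real_pos[of u] by simp
  show "(tanh has_real_derivative 1 - (tanh u)\<^sup>2) (at u)"
    using nz by (auto intro!: derivative_eq_intros)
  show "((\<lambda>u. 1 - (tanh u)\<^sup>2) has_real_derivative - 2 * tanh u + 2 * tanh u ^ 3) (at u)"
    using nz
    by (auto intro!: derivative_eq_intros simp: algebra_simps power2_eq_square power3_eq_cube)
qed

section \<open>The rescaled profiles\<close>

text \<open>\<open>G1^2\<close> and \<open>G2^2\<close> are the zeros of
  \<open>h0 * X^2 + g0 * X + 2 * H0\<close>, so their sum is \<open>- g0 / h0\<close>. This sum is
  what the linear coefficient of the rescaled \<open>dn\<close> equation produces.\<close>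

lemma solves_duffing_dn_profile:
  assumes "h0 < 0" and "0 < g0" and H0: "H0 \<in> {g0\<^sup>2 / (8 * h0)<..<0}"
    and "\<sigma>\<^sup>2 = 1"
  defines "G1 \<equiv> G1_foc g0 h0 H0" and "G2 \<equiv> G2_foc g0 h0 H0"
  shows "solves_duffing g0 (2 * h0)
    (\<lambda>z. \<sigma> * G2 * jacobi_dn (sqrt (G2\<^sup>2 - G1\<^sup>2) / G2) (G2 * sqrt (- h0) * (z - \<xi>0)))"
proof -
  define \<Delta> where "\<Delta> = sqrt (g0\<^sup>2 - 8 * h0 * H0)"
  \<comment> \<open>The range of \<open>H0\<close> amounts to \<open>0 < \<Delta> < g0\<close>: the
    zeros are distinct and both positive, which places the modulus strictly between 0 and 1.\<close>
  have "0 < h0 * H0" "8 * h0 * H0 < g0\<^sup>2"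
    using assms by (auto simp: field_simps mult_neg_neg)
  then have "0 < \<Delta>" "\<Delta> < sqrt (g0\<^sup>2)"
    unfolding \<Delta>_def by (simp, subst real_sqrt_less_iff, linarith)
  then have \<Delta>: "0 < \<Delta>" "\<Delta> < g0"
    using \<open>0 < g0\<close> by auto
  have G1: "G1\<^sup>2 = (g0 - \<Delta>) / (- 2 * h0)" and G2: "G2\<^sup>2 = (g0 + \<Delta>) / (- 2 * h0)"
    using \<Delta> assms by (simp_all add: G1_foc_def G2_foc_def \<Delta>_def[symmetric] divide_nonneg_neg
        divide_nonpos_neg)
  have pos: "0 < G1\<^sup>2" "G1\<^sup>2 < G2\<^sup>2"
    unfolding G1 G2 using \<Delta> \<open>h0 < 0\<close> by (auto simp: divide_simps)
  have "0 < G2"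
    using less_trans[OF pos] unfolding G2
    by (simp add: G2_def G2_foc_def \<Delta>_def[symmetric])
  define l where "l = sqrt (G2\<^sup>2 - G1\<^sup>2) / G2"
  have l2: "l\<^sup>2 * G2\<^sup>2 = G2\<^sup>2 - G1\<^sup>2"
    using pos \<open>0 < G2\<close> by (simp add: l_def power_divide)
  have "0 < l"
    using pos \<open>0 < G2\<close> by (simp add: l_def)
  moreover have "l < 1"
    using pos \<open>0 < G2\<close> real_sqrt_less_mono[of "G2\<^sup>2 - G1\<^sup>2" "G2\<^sup>2"] by (simp add: l_def)
  ultimately show ?thesis
    unfolding l_def[symmetric]
  proof (intro solves_duffing_rescale[OF solves_duffing_jacobi_dn])
    have "(G2 * sqrt (- h0))\<^sup>2 * (2 - l\<^sup>2) = - h0 * (2 * G2\<^sup>2 - l\<^sup>2 * G2\<^sup>2)"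
      using \<open>h0 < 0\<close> by (simp add: power_mult_distrib algebra_simps)
    also have "\<dots> = g0"
      unfolding l2 unfolding G1 G2 using \<open>h0 < 0\<close> by (simp add: field_simps)
    finally show "g0 = (G2 * sqrt (- h0))\<^sup>2 * (2 - l\<^sup>2)" ..
    show "2 * h0 * (\<sigma> * G2)\<^sup>2 = (G2 * sqrt (- h0))\<^sup>2 * - 2"
      using \<open>h0 < 0\<close> \<open>\<sigma>\<^sup>2 = 1\<close> by (simp add: power_mult_distrib)
  qed
qed

text \<open>For positive \<open>H0\<close> one zero of the quadratic is negative, namely
  \<open>- G3^2\<close>, and the sum of the zeros reads \<open>G2^2 - G3^2 = - g0 / h0\<close>. The
  modulus is below 1 because \<open>G3^2\<close> is positive.\<close>

lemma solves_duffing_cn_profile: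
  assumes "h0 < 0" and "0 < g0" and "0 < H0" and "\<sigma>\<^sup>2 = 1"
  defines "G2 \<equiv> G2_foc g0 h0 H0" and "G3 \<equiv> G3_foc g0 h0 H0"
  shows "solves_duffing g0 (2 * h0)
    (\<lambda>z. \<sigma> * G2 * jacobi_cn (G2 / sqrt (G2\<^sup>2 + G3\<^sup>2))
       (sqrt (- h0) * sqrt (G2\<^sup>2 + G3\<^sup>2) * (z - \<xi>0)))"
proof -
  define \<Delta> where "\<Delta> = sqrt (g0\<^sup>2 - 8 * h0 * H0)"
  have "h0 * H0 < 0"
    using assms by (simp add: mult_neg_pos)
  then have "sqrt (g0\<^sup>2) < \<Delta>"
    unfolding \<Delta>_def by (subst real_sqrt_less_iff) linarith
  then have \<Delta>: "g0 < \<Delta>"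
    using \<open>0 < g0\<close> by auto
  have G2: "G2\<^sup>2 = (g0 + \<Delta>) / (- 2 * h0)" and G3: "G3\<^sup>2 = (- g0 + \<Delta>) / (- 2 * h0)"
    using \<Delta> assms by (simp_all add: G2_foc_def G3_foc_def \<Delta>_def[symmetric] divide_nonneg_neg
        divide_nonpos_neg)
  have pos: "0 < G2\<^sup>2" "0 < G3\<^sup>2"
    unfolding G2 G3 using \<Delta> \<open>0 < g0\<close> \<open>h0 < 0\<close> by (auto simp: divide_simps)
  define S where "S = sqrt (G2\<^sup>2 + G3\<^sup>2)"
  have S: "0 < S" "S\<^sup>2 = G2\<^sup>2 + G3\<^sup>2"
    using pos by (simp_all add: S_def add_pos_pos)
  have "0 < G2"
    using pos(1) unfolding G2
    by (simp add: G2_def G2_foc_def \<Delta>_def[symmetric])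
  moreover have "G2 < S"
    using real_sqrt_less_mono[of "G2\<^sup>2" "G2\<^sup>2 + G3\<^sup>2"] pos(2) \<open>0 < G2\<close> by (simp add: S_def)
  ultimately have "0 < G2 / S" "G2 / S < 1"
    using S(1) by auto
  then show ?thesis
    unfolding S_def[symmetric]
  proof (intro solves_duffing_rescale[OF solves_duffing_jacobi_cn])
    have "(sqrt (- h0) * S)\<^sup>2 * (2 * (G2 / S)\<^sup>2 - 1) = - h0 * (2 * G2\<^sup>2 - S\<^sup>2)"
      using \<open>h0 < 0\<close> S(1) by (simp add: power_mult_distrib power_divide field_simps)
    also have "\<dots> = g0"
      unfolding S(2) G2 G3 using \<open>h0 < 0\<close> by (simp add: field_simps)
    finally show "g0 = (sqrt (- h0) * S)\<^sup>2 * (2 * (G2 / S)\<^sup>2 - 1)" ..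
    show "2 * h0 * (\<sigma> * G2)\<^sup>2 = (sqrt (- h0) * S)\<^sup>2 * (- 2 * (G2 / S)\<^sup>2)"
      using \<open>h0 < 0\<close> S(1) \<open>\<sigma>\<^sup>2 = 1\<close> by (simp add: power_mult_distrib power_divide)
  qed
qed

text \<open>Again the linear coefficient comes from \<open>G1^2 + G2^2 = - g0 / h0\<close>; the
  range of \<open>H0\<close> gives \<open>0 < \<Delta> < - g0\<close> and hence
  \<open>0 < G1 < G2\<close>.\<close>

lemma solves_duffing_sn_profile:
  assumes "0 < h0" and "g0 < 0" and H0: "H0 \<in> {0<..<g0\<^sup>2 / (8 * h0)}" and "\<sigma>\<^sup>2 = 1"
  defines "G1 \<equiv> G1_defoc g0 h0 H0" and "G2 \<equiv> G2_defoc g0 h0 H0"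
  shows "solves_duffing g0 (2 * h0)
    (\<lambda>z. \<sigma> * G1 * jacobi_sn (G1 / G2) (sqrt h0 * G2 * (z - \<xi>0)))"
proof -
  define \<Delta> where "\<Delta> = sqrt (g0\<^sup>2 - 8 * h0 * H0)"
  have "0 < h0 * H0" "8 * h0 * H0 < g0\<^sup>2"
    using assms by (auto simp: field_simps)
  then have "0 < \<Delta>" "\<Delta> < sqrt (g0\<^sup>2)"
    unfolding \<Delta>_def by (simp, subst real_sqrt_less_iff, linarith)
  then have \<Delta>: "0 < \<Delta>" "\<Delta> < - g0"
    using \<open>g0 < 0\<close> by auto
  have G1: "G1\<^sup>2 = (- g0 - \<Delta>) / (2 * h0)" and G2: "G2\<^sup>2 = (- g0 + \<Delta>) / (2 * h0)"
    using \<Delta> assms by (simp_all add: G1_defoc_def G2_defoc_def \<Delta>_def[symmetric])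
  have "0 < (- g0 - \<Delta>) / (2 * h0)" "(- g0 - \<Delta>) / (2 * h0) < (- g0 + \<Delta>) / (2 * h0)"
    using \<Delta> \<open>0 < h0\<close> by (auto simp: divide_strict_right_mono)
  then have pos: "0 < G1" "G1 < G2"
    unfolding G1_def G2_def G1_defoc_def G2_defoc_def \<Delta>_def[symmetric] by simp_all
  then have "0 < G1 / G2" "G1 / G2 < 1"
    by auto
  then show ?thesis
  proof (intro solves_duffing_rescale[OF solves_duffing_jacobi_sn])
    have "(sqrt h0 * G2)\<^sup>2 * - (1 + (G1 / G2)\<^sup>2) = - h0 * (G2\<^sup>2 + G1\<^sup>2)"
      using \<open>0 < h0\<close> pos by (simp add: power_mult_distrib power_divide field_simps)
    also have "\<dots> = g0"
      unfolding G1 G2 using \<open>0 < h0\<close> by (simp add: field_simps)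
    finally show "g0 = (sqrt h0 * G2)\<^sup>2 * - (1 + (G1 / G2)\<^sup>2)" ..
    show "2 * h0 * (\<sigma> * G1)\<^sup>2 = (sqrt h0 * G2)\<^sup>2 * (2 * (G1 / G2)\<^sup>2)"
      using \<open>0 < h0\<close> pos \<open>\<sigma>\<^sup>2 = 1\<close> by (simp add: power_mult_distrib power_divide)
  qed
qed

lemma solves_duffing_sech_profile:
  assumes "h0 < 0" and "0 < g0" and "\<sigma>\<^sup>2 = 1"
  shows "solves_duffing g0 (2 * h0) (\<lambda>z. \<sigma> * sqrt (- g0 / h0) * sech (sqrt g0 * (z - \<xi>0)))"
  using assms
  by (intro solves_duffing_rescale[OF solves_duffing_sech])
    (auto simp: power_mult_distrib divide_nonneg_neg divide_nonpos_neg)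

lemma solves_duffing_tanh_profile:
  assumes "0 < h0" and "g0 < 0" and "\<sigma>\<^sup>2 = 1"
  shows "solves_duffing g0 (2 * h0)
    (\<lambda>z. \<sigma> * sqrt (- g0 / (2 * h0)) * tanh (sqrt (- g0 / 2) * (z - \<xi>0)))"
  using assms
  by (intro solves_duffing_rescale[OF solves_duffing_tanh])
    (auto simp: power_mult_distrib divide_nonpos_pos)

lemma solves_duffing_const:
  assumes "g0 * A + 2 * h0 * A ^ 3 = 0"
  shows "solves_duffing g0 (2 * h0) (\<lambda>z. A)"
  unfolding solves_duffing_def assms by (intro exI[of _ "\<lambda>z. 0"]) auto

section \<open>The modulated ansatz\<close>

text \<open>The derivative keeps the exponential as a common left factor, so the phase cancels from
  the equation. A complex \<open>r\<close> allows a second application, to the first derivative, and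
  the set \<open>S\<close> covers time derivatives within \<open>I\<close>.\<close>

lemma has_vector_derivative_phase_mult:
  fixes f :: "real \<Rightarrow> real" and r :: "real \<Rightarrow> complex"
  assumes "(f has_real_derivative f') (at t within S)"
    and "(r has_vector_derivative r') (at t within S)"
  shows "((\<lambda>t. exp (\<i> * of_real (f t)) * r t) has_vector_derivative
    exp (\<i> * of_real (f t)) * (\<i> * of_real f' * r t + r')) (at t within S)"
proof -
  have "((\<lambda>t. \<i> * of_real (f t)) has_vector_derivative \<i> * of_real f') (at t within S)"
    using assms(1)
    by (intro has_vector_derivative_mult_right has_vector_derivative_of_real)
  then have "((\<lambda>t. exp (\<i> * of_real (f t))) has_vector_derivative
      \<i> * of_real f' * exp (\<i> * of_real (f t))) (at t within S)"
    using field_vector_diff_chain_within[where g = exp and g' = "exp (\<i> * of_real (f t))"]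
    by (auto simp: o_def DERIV_exp has_field_derivative_at_within)
  from has_vector_derivative_mult[OF this assms(2)] show ?thesis
    by (simp add: algebra_simps)
qed

text \<open>
  The two equations of the system are the cases \<open>s = 1\<close> and \<open>s = -1\<close>, with \<open>N\<close> the total intensity.
\<close>

definition solves_signed_nls ::
  "real set \<Rightarrow> (real \<Rightarrow> real) \<Rightarrow> (real \<Rightarrow> real) \<Rightarrow> (real \<Rightarrow> real) \<Rightarrow> (real \<Rightarrow> real) \<Rightarrow>
   (real \<Rightarrow> real) \<Rightarrow> (real \<Rightarrow> real) \<Rightarrow> real \<Rightarrow> (real \<Rightarrow> real \<Rightarrow> real) \<Rightarrow>
   (real \<Rightarrow> real \<Rightarrow> complex) \<Rightarrow> bool" where
  "solves_signed_nls I a b c d g h s N u \<longleftrightarrow>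
     (\<exists>ut ux uxx. \<forall>x. \<forall>t\<in>I.
       ((\<lambda>r. u x r) has_vector_derivative ut x t) (at t within I) \<and>
       ((\<lambda>y. u y t) has_vector_derivative ux x t) (at x) \<and>
       ((\<lambda>y. ux y t) has_vector_derivative uxx x t) (at x) \<and>
       \<i> * ut x t =
         of_real s * (- of_real (a t) * uxx x t + of_real (b t) * of_real (x\<^sup>2) * u x t
           + of_real (g t) * u x t + of_real (h t) * of_real (N x t) * u x t)
         - \<i> * of_real (c t) * of_real x * ux x t - \<i> * of_real (d t) * u x t)"

text \<open>Treating the intensity as a given function \<open>N\<close> decouples the two equations.
  The \<open>c\<close> and \<open>d\<close> terms have the same sign in both and therefore stand
  outside the factor \<open>s\<close>.\<close>

lemma solves_coupled_nlsI:
  assumes "solves_signed_nls I a b c d g h 1 N \<psi>" and "solves_signed_nls I a b c d g h (- 1) N \<phi>"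
    and "\<And>x t. N x t = (cmod (\<psi> x t))\<^sup>2 + (cmod (\<phi> x t))\<^sup>2"
  shows "solves_coupled_nls I a b c d g h \<psi> \<phi>"
proof -
  obtain \<psi>t \<psi>x \<psi>xx where \<psi>: "\<forall>x. \<forall>t\<in>I.
       ((\<lambda>r. \<psi> x r) has_vector_derivative \<psi>t x t) (at t within I) \<and>
       ((\<lambda>y. \<psi> y t) has_vector_derivative \<psi>x x t) (at x) \<and>
       ((\<lambda>y. \<psi>x y t) has_vector_derivative \<psi>xx x t) (at x) \<and>
       \<i> * \<psi>t x t =
         of_real 1 * (- of_real (a t) * \<psi>xx x t + of_real (b t) * of_real (x\<^sup>2) * \<psi> x t
           + of_real (g t) * \<psi> x t + of_real (h t) * of_real (N x t) * \<psi> x t)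
         - \<i> * of_real (c t) * of_real x * \<psi>x x t - \<i> * of_real (d t) * \<psi> x t"
    using assms(1) unfolding solves_signed_nls_def by blast
  obtain \<phi>t \<phi>x \<phi>xx where \<phi>: "\<forall>x. \<forall>t\<in>I.
       ((\<lambda>r. \<phi> x r) has_vector_derivative \<phi>t x t) (at t within I) \<and>
       ((\<lambda>y. \<phi> y t) has_vector_derivative \<phi>x x t) (at x) \<and>
       ((\<lambda>y. \<phi>x y t) has_vector_derivative \<phi>xx x t) (at x) \<and>
       \<i> * \<phi>t x t =
         of_real (- 1) * (- of_real (a t) * \<phi>xx x t + of_real (b t) * of_real (x\<^sup>2) * \<phi> x t
           + of_real (g t) * \<phi> x t + of_real (h t) * of_real (N x t) * \<phi> x t)
         - \<i> * of_real (c t) * of_real x * \<phi>x x t - \<i> * of_real (d t) * \<phi> x t"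
    using assms(2) unfolding solves_signed_nls_def by blast
  show ?thesis
    unfolding solves_coupled_nls_def assms(3)[symmetric]
  proof (intro exI allI ballI conjI)
    fix x t assume t: "t \<in> I"
    note \<psi>\<phi> = \<psi>[rule_format, OF t] \<phi>[rule_format, OF t]
    show "((\<lambda>s. \<psi> x s) has_vector_derivative \<psi>t x t) (at t within I)"
      "((\<lambda>y. \<psi> y t) has_vector_derivative \<psi>x x t) (at x)"
      "((\<lambda>y. \<psi>x y t) has_vector_derivative \<psi>xx x t) (at x)"
      "((\<lambda>s. \<phi> x s) has_vector_derivative \<phi>t x t) (at t within I)"
      "((\<lambda>y. \<phi> y t) has_vector_derivative \<phi>x x t) (at x)"
      "((\<lambda>y. \<phi>x y t) has_vector_derivative \<phi>xx x t) (at x)"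
      using \<psi>\<phi> by blast+
    show "\<i> * \<psi>t x t =
           - of_real (a t) * \<psi>xx x t + of_real (b t) * of_real (x\<^sup>2) * \<psi> x t
           - \<i> * of_real (c t) * of_real x * \<psi>x x t - \<i> * of_real (d t) * \<psi> x t
           + of_real (g t) * \<psi> x t + of_real (h t) * of_real (N x t) * \<psi> x t"
      using \<psi>\<phi>(1) by (simp add: algebra_simps)
    show "\<i> * \<phi>t x t =
           of_real (a t) * \<phi>xx x t - of_real (b t) * of_real (x\<^sup>2) * \<phi> x t
           - \<i> * of_real (c t) * of_real x * \<phi>x x t - \<i> * of_real (d t) * \<phi> x t
           - of_real (g t) * \<phi> x t - of_real (h t) * of_real (N x t) * \<phi> x t"
      using \<psi>\<phi>(2) by (simp add: algebra_simps)
  qed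
qed

text \<open>Both fields have modulus \<open>\<bar>G\<bar>\<close>, so the intensity is
  \<open>2 * G^2\<close>; this explains the cubic coefficient \<open>2 * h0\<close>. Both signs are
  handled at once because \<open>s^2 = 1\<close>.\<close>

lemma modulated_profile_solves_nls:
  fixes I :: "real set" and a b c d g h \<alpha> \<beta> \<gamma> \<alpha>' \<beta>' \<gamma>' G :: "real \<Rightarrow> real"
    and \<theta> \<xi> :: "real \<Rightarrow> real \<Rightarrow> real" and g0 h0 s :: real
  assumes G: "solves_duffing g0 (2 * h0) G"
    and \<alpha>: "\<And>t. t \<in> I \<Longrightarrow> (\<alpha> has_real_derivative \<alpha>' t) (at t within I)"
    and \<beta>: "\<And>t. t \<in> I \<Longrightarrow> (\<beta> has_real_derivative \<beta>' t) (at t within I)"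
    and \<gamma>: "\<And>t. t \<in> I \<Longrightarrow> (\<gamma> has_real_derivative \<gamma>' t) (at t within I)"
    and \<alpha>': "\<And>t. t \<in> I \<Longrightarrow> \<alpha>' t + b t + 2 * c t * \<alpha> t + 4 * a t * (\<alpha> t)\<^sup>2 = 0"
    and \<beta>': "\<And>t. t \<in> I \<Longrightarrow> \<beta>' t + (c t + 4 * a t * \<alpha> t) * \<beta> t = 0"
    and \<gamma>': "\<And>t. t \<in> I \<Longrightarrow> \<gamma>' t + a t * (\<beta> t)\<^sup>2 = 0"
    and d: "\<And>t. t \<in> I \<Longrightarrow> d t = - 2 * a t * \<alpha> t"
    and g: "\<And>t. t \<in> I \<Longrightarrow> g t = g0 * a t * (\<beta> t)\<^sup>2"
    and h: "\<And>t. t \<in> I \<Longrightarrow> h t = h0 * a t * (\<beta> t)\<^sup>2"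
    and \<theta>: "\<And>x t. \<theta> x t = \<alpha> t * x\<^sup>2 + \<beta> t * x + \<gamma> t"
    and \<xi>: "\<And>x t. \<xi> x t = \<beta> t * x + 2 * \<gamma> t"
    and s: "s \<in> {1, -1}"
    and u: "\<And>x t. u x t = exp (\<i> * of_real (s * \<theta> x t)) * of_real (G (\<xi> x t))"
  shows "solves_signed_nls I a b c d g h s (\<lambda>x t. 2 * (G (\<xi> x t))\<^sup>2) u"
proof -
  obtain G' where G': "\<And>z. (G has_real_derivative G' z) (at z)"
    and G'': "\<And>z. (G' has_real_derivative g0 * G z + 2 * h0 * (G z) ^ 3) (at z)"
    using G unfolding solves_duffing_def by blast
  define e where "e x t = exp (\<i> * of_real (s * \<theta> x t))" for x t
  define \<theta>x where "\<theta>x x t = 2 * \<alpha> t * x + \<beta> t" for x t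
  define \<theta>t where "\<theta>t x t = \<alpha>' t * x\<^sup>2 + \<beta>' t * x + \<gamma>' t" for x t
  define \<xi>t where "\<xi>t x t = \<beta>' t * x + 2 * \<gamma>' t" for x t
  define ut where "ut x t = e x t * (\<i> * of_real (s * \<theta>t x t) * of_real (G (\<xi> x t))
    + of_real (G' (\<xi> x t) * \<xi>t x t))" for x t
  \<comment> \<open>\<open>R\<close> is \<open>ux\<close> stripped of the phase. \<open>Rx\<close>
    is its derivative in \<open>x\<close>, with the second derivative of \<open>G\<close> replaced
    by the Duffing right-hand side.\<close>
  define R where "R x t = \<i> * of_real (s * \<theta>x x t) * of_real (G (\<xi> x t))
    + of_real (G' (\<xi> x t) * \<beta> t)" for x t
  define Rx where "Rx x t = \<i> * of_real (s * (2 * \<alpha> t * G (\<xi> x t) + \<theta>x x t * (G' (\<xi> x t) * \<beta> t)))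
    + of_real ((g0 * G (\<xi> x t) + 2 * h0 * (G (\<xi> x t)) ^ 3) * \<beta> t * \<beta> t)" for x t
  define ux where "ux x t = e x t * R x t" for x t
  define uxx where "uxx x t = e x t * (\<i> * of_real (s * \<theta>x x t) * R x t + Rx x t)" for x t
  have \<theta>_x: "((\<lambda>y. s * \<theta> y t) has_real_derivative s * \<theta>x x t) (at x)" for x t
    unfolding \<theta> \<theta>x_def by (auto intro!: derivative_eq_intros)
  have \<xi>_x: "((\<lambda>y. \<xi> y t) has_real_derivative \<beta> t) (at x)" for x t
    unfolding \<xi> by (auto intro!: derivative_eq_intros)
  have "((\<lambda>r. u x r) has_vector_derivative ut x t) (at t within I)" if "t \<in> I" for x t
    unfolding u ut_def e_def
  proof (intro has_vector_derivative_phase_mult has_vector_derivative_of_real DERIV_chain2[OF G'])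
    show "((\<lambda>r. s * \<theta> x r) has_real_derivative s * \<theta>t x t) (at t within I)"
      unfolding \<theta> \<theta>t_def by (auto intro!: derivative_eq_intros \<alpha> \<beta> \<gamma> that)
    show "((\<lambda>r. \<xi> x r) has_real_derivative \<xi>t x t) (at t within I)"
      unfolding \<xi> \<xi>t_def by (auto intro!: derivative_eq_intros \<beta> \<gamma> that)
  qed
  moreover have "((\<lambda>y. u y t) has_vector_derivative ux x t) (at x)" for x t
    unfolding u ux_def R_def e_def
    by (intro has_vector_derivative_phase_mult has_vector_derivative_of_real DERIV_chain2[OF G']
        \<theta>_x \<xi>_x)
  moreover have "((\<lambda>y. ux y t) has_vector_derivative uxx x t) (at x)" for x t
    unfolding ux_def uxx_def e_def
  proof (intro has_vector_derivative_phase_mult \<theta>_x)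
    have "((\<lambda>y. s * (\<theta>x y t * G (\<xi> y t))) has_real_derivative
        s * (2 * \<alpha> t * G (\<xi> x t) + \<theta>x x t * (G' (\<xi> x t) * \<beta> t))) (at x)"
      unfolding \<theta>x_def
      by (auto intro!: derivative_eq_intros DERIV_chain2[OF G'] \<xi>_x simp: algebra_simps)
    moreover have "((\<lambda>y. G' (\<xi> y t) * \<beta> t) has_real_derivative
        (g0 * G (\<xi> x t) + 2 * h0 * (G (\<xi> x t)) ^ 3) * \<beta> t * \<beta> t) (at x)"
      by (auto intro!: derivative_eq_intros DERIV_chain2[OF G''] \<xi>_x)
    ultimately have "((\<lambda>y. \<i> * of_real (s * (\<theta>x y t * G (\<xi> y t))) + of_real (G' (\<xi> y t) * \<beta> t))
        has_vector_derivative Rx x t) (at x)"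
      unfolding Rx_def
      by (intro has_vector_derivative_add has_vector_derivative_mult_right
          has_vector_derivative_of_real)
    then show "((\<lambda>y. R y t) has_vector_derivative Rx x t) (at x)"
      unfolding R_def by (simp add: mult_ac)
  qed
  moreover have "\<i> * ut x t =
      of_real s * (- of_real (a t) * uxx x t + of_real (b t) * of_real (x\<^sup>2) * u x t
        + of_real (g t) * u x t + of_real (h t) * of_real (2 * (G (\<xi> x t))\<^sup>2) * u x t)
      - \<i> * of_real (c t) * of_real x * ux x t - \<i> * of_real (d t) * u x t"
    if t: "t \<in> I" for x t
  proof -
    let ?z = "\<xi> x t"
    \<comment> \<open>Real part, divided by \<open>s\<close>. The Duffing terms cancel against
      \<open>g\<close> and \<open>h\<close>; what remains is a quadratic in \<open>x\<close> whose
      coefficients vanish by the equations for \<alpha>, \<beta> and \<gamma>.\<close>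
    have "- (\<theta>t x t * G ?z) = a t * ((\<theta>x x t)\<^sup>2 * G ?z
        - (g0 * G ?z + 2 * h0 * (G ?z) ^ 3) * (\<beta> t)\<^sup>2)
        + b t * x\<^sup>2 * G ?z + g t * G ?z + h t * (2 * (G ?z)\<^sup>2) * G ?z
        + c t * x * (\<theta>x x t * G ?z)"
      unfolding \<theta>t_def \<theta>x_def g[OF t] h[OF t] using \<alpha>'[OF t] \<beta>'[OF t] \<gamma>'[OF t] by algebra
    \<comment> \<open>Imaginary part. The terms in \<open>G\<close> cancel by the choice of
      \<open>d\<close>, and those in \<open>G'\<close> because \<xi> is transported with velocity
      \<open>2 * a * \<theta>x + c * x\<close>.\<close>
    moreover have "G' ?z * \<xi>t x t = - a t * (2 * \<alpha> t * G ?z + 2 * \<theta>x x t * (G' ?z * \<beta> t))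
        - c t * x * (G' ?z * \<beta> t) - d t * G ?z"
      unfolding \<xi>t_def \<theta>x_def d[OF t] using \<beta>'[OF t] \<gamma>'[OF t] by algebra
    ultimately have "\<i> * (\<i> * of_real (s * \<theta>t x t) * of_real (G ?z) + of_real (G' ?z * \<xi>t x t)) =
      of_real s * (- of_real (a t) * (\<i> * of_real (s * \<theta>x x t) * R x t + Rx x t)
        + of_real (b t) * of_real (x\<^sup>2) * of_real (G ?z)
        + of_real (g t) * of_real (G ?z) + of_real (h t) * of_real (2 * (G ?z)\<^sup>2) * of_real (G ?z))
      - \<i> * of_real (c t) * of_real x * R x t - \<i> * of_real (d t) * of_real (G ?z)"
      using s unfolding R_def Rx_def
      by (auto simp: complex_eq_iff power2_eq_square algebra_simps)
    \<comment> \<open>Multiplying by the phase \<open>e x t\<close> turns the reduced identity back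
      into the equation for \<open>u\<close>.\<close>
    from arg_cong[OF this, of "\<lambda>z. e x t * z"] show ?thesis
      unfolding ut_def uxx_def ux_def u e_def[symmetric] by (simp only: algebra_simps)
  qed
  ultimately show ?thesis
    unfolding solves_signed_nls_def
    by (intro exI[of _ ut] exI[of _ ux] exI[of _ uxx]) blast
qed

theorem mainTheorem1:
  fixes I :: "real set"
    and a b c d g h :: "real \<Rightarrow> real"
    and \<alpha> \<beta> \<gamma> \<alpha>' \<beta>' \<gamma>' :: "real \<Rightarrow> real"
    and \<theta> \<xi> :: "real \<Rightarrow> real \<Rightarrow> real"
    and g0 h0 H0 \<xi>0 \<sigma> :: real
    and G :: "real \<Rightarrow> real"
  assumes "is_interval I" and "0 \<in> I"
    and "continuous_on I a" and "continuous_on I b" and "continuous_on I c"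
    and "continuous_on I d" and "continuous_on I g" and "continuous_on I h"
    and "g0 \<noteq> 0" and "h0 \<noteq> 0"
    and "\<And>t. t \<in> I \<Longrightarrow> (\<alpha> has_real_derivative \<alpha>' t) (at t within I)"
    and "\<And>t. t \<in> I \<Longrightarrow> (\<beta> has_real_derivative \<beta>' t) (at t within I)"
    and "\<And>t. t \<in> I \<Longrightarrow> (\<gamma> has_real_derivative \<gamma>' t) (at t within I)"
    and "\<And>t. t \<in> I \<Longrightarrow> \<alpha>' t + b t + 2 * c t * \<alpha> t + 4 * a t * (\<alpha> t)\<^sup>2 = 0"
    and "\<And>t. t \<in> I \<Longrightarrow> \<beta>' t + (c t + 4 * a t * \<alpha> t) * \<beta> t = 0"
    and "\<And>t. t \<in> I \<Longrightarrow> \<gamma>' t + a t * (\<beta> t)\<^sup>2 = 0"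
    and "\<And>t. t \<in> I \<Longrightarrow> d t = - 2 * a t * \<alpha> t"
    and "\<And>t. t \<in> I \<Longrightarrow> g t = g0 * a t * (\<beta> t)\<^sup>2"
    and "\<And>t. t \<in> I \<Longrightarrow> h t = h0 * a t * (\<beta> t)\<^sup>2"
    and "\<And>x t. \<theta> x t = \<alpha> t * x\<^sup>2 + \<beta> t * x + \<gamma> t"
    and "\<And>x t. \<xi> x t = \<beta> t * x + 2 * \<gamma> t"
    and "\<sigma> \<in> {1, -1}"
    and "(h0 < 0 \<and> g0 > 0 \<and>
           (let G1 = G1_foc g0 h0 H0; G2 = G2_foc g0 h0 H0; G3 = G3_foc g0 h0 H0 in
             (H0 \<in> {g0\<^sup>2 / (8 * h0)<..<0} \<and>
               G = (\<lambda>z. \<sigma> * G2 * jacobi_dn (sqrt (G2\<^sup>2 - G1\<^sup>2) / G2)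
                                    (G2 * sqrt (- h0) * (z - \<xi>0)))) \<or>
             (H0 = 0 \<and>
               G = (\<lambda>z. \<sigma> * sqrt (- g0 / h0) * sech (sqrt g0 * (z - \<xi>0)))) \<or>
             (H0 = g0\<^sup>2 / (8 * h0) \<and>
               G = (\<lambda>z. \<sigma> * sqrt (- g0 / (2 * h0)))) \<or>
             (H0 > 0 \<and>
               G = (\<lambda>z. \<sigma> * G2 * jacobi_cn (G2 / sqrt (G2\<^sup>2 + G3\<^sup>2))
                                    (sqrt (- h0) * sqrt (G2\<^sup>2 + G3\<^sup>2) * (z - \<xi>0)))))) \<or>
         (h0 > 0 \<and> g0 < 0 \<and>
           (let G1 = G1_defoc g0 h0 H0; G2 = G2_defoc g0 h0 H0 in
             (H0 \<in> {0<..<g0\<^sup>2 / (8 * h0)} \<and>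
               G = (\<lambda>z. \<sigma> * G1 * jacobi_sn (G1 / G2) (sqrt h0 * G2 * (z - \<xi>0)))) \<or>
             (H0 = g0\<^sup>2 / (8 * h0) \<and>
               G = (\<lambda>z. \<sigma> * sqrt (- g0 / (2 * h0)) * tanh (sqrt (- g0 / 2) * (z - \<xi>0))))))"
  shows "solves_coupled_nls I a b c d g h
           (\<lambda>x t. exp (\<i> * of_real (\<theta> x t)) * of_real (G (\<xi> x t)))
           (\<lambda>x t. exp (- \<i> * of_real (\<theta> x t)) * of_real (G (\<xi> x t)))"
proof -
  have \<sigma>: "\<sigma>\<^sup>2 = 1"
    using \<open>\<sigma> \<in> {1, -1}\<close> by auto
  \<comment> \<open>The constant amplitude is a nonzero equilibrium: its square solves
    \<open>g0 + 2 * h0 * X = 0\<close>.\<close>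
  have const: "solves_duffing g0 (2 * h0) (\<lambda>z. \<sigma> * sqrt (- g0 / (2 * h0)))"
    if "h0 < 0" "0 < g0"
  proof (rule solves_duffing_const)
    let ?A = "\<sigma> * sqrt (- g0 / (2 * h0))"
    have "?A\<^sup>2 = - g0 / (2 * h0)"
      using that \<sigma> by (simp add: power_mult_distrib divide_nonneg_neg divide_nonpos_neg)
    then have "g0 + 2 * h0 * ?A\<^sup>2 = 0"
      using that by simp
    then show "g0 * ?A + 2 * h0 * ?A ^ 3 = 0"
      by algebra
  qed
  have G: "solves_duffing g0 (2 * h0) G"
    using assms(23) \<sigma> solves_duffing_dn_profile solves_duffing_cn_profile
      solves_duffing_sn_profile solves_duffing_sech_profile solves_duffing_tanh_profile const
    unfolding Let_def by (elim disjE conjE) simp_all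
  show ?thesis
  proof (rule solves_coupled_nlsI)
    show "solves_signed_nls I a b c d g h 1 (\<lambda>x t. 2 * (G (\<xi> x t))\<^sup>2)
        (\<lambda>x t. exp (\<i> * of_real (\<theta> x t)) * of_real (G (\<xi> x t)))"
      by (rule modulated_profile_solves_nls[OF G, where \<theta> = \<theta> and \<xi> = \<xi> and \<alpha> = \<alpha>
          and \<alpha>' = \<alpha>' and \<beta>' = \<beta>' and \<gamma>' = \<gamma>'])
        (fact assms(11-21) | simp)+
    show "solves_signed_nls I a b c d g h (- 1) (\<lambda>x t. 2 * (G (\<xi> x t))\<^sup>2)
        (\<lambda>x t. exp (- \<i> * of_real (\<theta> x t)) * of_real (G (\<xi> x t)))"
      by (rule modulated_profile_solves_nls[OF G, where \<theta> = \<theta> and \<xi> = \<xi> and \<alpha> = \<alpha>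
          and \<alpha>' = \<alpha>' and \<beta>' = \<beta>' and \<gamma>' = \<gamma>'])
        (fact assms(11-21) | simp)+
    \<comment> \<open>Phases have modulus 1, so each field contributes the square of
      \<open>G\<close>.\<close>
    show "2 * (G (\<xi> x t))\<^sup>2 = (cmod (exp (\<i> * of_real (\<theta> x t)) * of_real (G (\<xi> x t))))\<^sup>2
        + (cmod (exp (- \<i> * of_real (\<theta> x t)) * of_real (G (\<xi> x t))))\<^sup>2" for x t
      by (simp add: norm_mult)
  qed
qed

end
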